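(* Let $k\ge 1$ and $d\ge 0$ be integers. With Replacement Eggs, the height $H_{\mathcal R,k}(d)$ of the tallest building for which the strength of the eggs can be determined starting with $k$ eggs and using no more than $d$ egg drops is $$H_{\mathcal R,k}(d)=-1+\sum_{i=0}^{\lfloor d/(k+1)\rfloor}(-1)^i\binom{d-ik}{i}2^{\,d-i(k+1)}.$$
   Context: Egg-drop problem: a building has floors $1,\dots,N$ (its height is $N$) and all eggs have the same unknown strength $s\in\{0,1,\dots,N\}$, every value being possible. An egg dropped from floor $x\in\{1,\dots,N\}$ survives if $x\le s$ and breaks if $x>s$. One starts with $k$ eggs; a drop can be made only if at least one egg is in hand; the floor of each drop may be chosen depending on the outcomes of the previous drops. Replacement Eggs: each time an egg breaks the number of eggs in hand decreases by one, and each time a dropped egg does not break the supply of eggs is restored to the original number $k$. $H_{\mathcal R,k}(d)$ is the largest $N$ for which there is a deterministic adaptive strategy, obeying these egg-supply rules, that determines $s$ using at most $d$ drops for every possible $s\in\{0,1,\dots,N\}$. *)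

theory Defs
  imports Complex_Main
begin

text \<open>An adaptive strategy is a decision tree. \<open>Announce g\<close> stops and declares the strength to
  be \<open>g\<close>. \<open>Drop x b c\<close> drops an egg from floor \<open>x\<close> and continues with \<open>b\<close> if the egg breaks and
  with \<open>c\<close> if it survives.\<close>

datatype strategy = Announce nat | Drop nat strategy strategy

primrec announced :: "nat \<Rightarrow> strategy \<Rightarrow> nat" where
  "announced s (Announce g) = g"
| "announced s (Drop x b c) = (if x \<le> s then announced s c else announced s b)"

primrec drops_used :: "nat \<Rightarrow> strategy \<Rightarrow> nat" where
  "drops_used s (Announce g) = 0"
| "drops_used s (Drop x b c) = Suc (if x \<le> s then drops_used s c else drops_used s b)"

text \<open>\<open>obeys_replacement N k s e t\<close>: with \<open>e\<close> eggs in hand and original supply \<open>k\<close>, the run of \<open>t\<close>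
  on eggs of strength \<open>s\<close> uses only floors of the building of height \<open>N\<close> and never drops an egg
  when none is in hand. A surviving drop resets the supply to \<open>k\<close>.\<close>

primrec obeys_replacement :: "nat \<Rightarrow> nat \<Rightarrow> nat \<Rightarrow> nat \<Rightarrow> strategy \<Rightarrow> bool" where
  "obeys_replacement N k s e (Announce g) \<longleftrightarrow> True"
| "obeys_replacement N k s e (Drop x b c) \<longleftrightarrow>
     x \<in> {1..N} \<and> e \<ge> 1 \<and>
     (if x \<le> s then obeys_replacement N k s k c else obeys_replacement N k s (e - 1) b)"

definition determines_strength :: "nat \<Rightarrow> nat \<Rightarrow> nat \<Rightarrow> strategy \<Rightarrow> bool" where
  "determines_strength N k d t \<longleftrightarrow>
     (\<forall>s\<in>{0..N}. obeys_replacement N k s k t \<and> drops_used s t \<le> d \<and> announced s t = s)"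

definition replacement_height :: "nat \<Rightarrow> nat \<Rightarrow> nat" where
  "replacement_height k d = Max {N. \<exists>t. determines_strength N k d t}"

text \<open>The maximum is taken over a finite nonempty set, so it is a genuine maximum.\<close>

lemma announced_image_bound:
  "finite ((\<lambda>s. announced s t) ` {s. drops_used s t \<le> d}) \<and>
   card ((\<lambda>s. announced s t) ` {s. drops_used s t \<le> d}) \<le> 2 ^ d"
proof (induction t arbitrary: d)
  case (Announce g)
  have "(\<lambda>s. announced s (Announce g)) ` {s. drops_used s (Announce g) \<le> d} = {g}"
    by auto
  then show ?case by simp
next
  case (Drop x b c)
  let ?I = "\<lambda>t d. (\<lambda>s. announced s t) ` {s. drops_used s t \<le> d}"
  show ?case
  proof (cases d)
    case 0
    then show ?thesis by simp
  next
    case (Suc m)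
    have sub: "?I (Drop x b c) d \<subseteq> ?I b m \<union> ?I c m"
      using Suc by (auto split: if_splits)
    have fin: "finite (?I b m \<union> ?I c m)"
      using Drop.IH by blast
    have "card (?I b m \<union> ?I c m) \<le> card (?I b m) + card (?I c m)"
      by (rule card_Un_le)
    also have "\<dots> \<le> 2 ^ m + 2 ^ m"
      using Drop.IH by (intro add_mono) blast+
    finally have "card (?I b m \<union> ?I c m) \<le> 2 ^ d"
      using Suc by simp
    then show ?thesis
      using finite_subset[OF sub fin] card_mono[OF fin sub] by linarith
  qed
qed

lemma determines_strength_bound:
  assumes "determines_strength N k d t"
  shows "N < 2 ^ d"
proof -
  let ?A = "(\<lambda>s. announced s t) ` {s. drops_used s t \<le> d}"
  have "{0..N} \<subseteq> ?A"
    using assms by (force simp: determines_strength_def image_iff)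
  then have "card {0..N} \<le> card ?A"
    using announced_image_bound by (intro card_mono) blast+
  also have "\<dots> \<le> 2 ^ d"
    using announced_image_bound by blast
  finally show ?thesis by simp
qed

lemma replacement_height_greatest:
  "(\<exists>t. determines_strength (replacement_height k d) k d t) \<and>
   (\<forall>N t. determines_strength N k d t \<longrightarrow> N \<le> replacement_height k d)"
proof -
  let ?S = "{N. \<exists>t. determines_strength N k d t}"
  have "?S \<subseteq> {..<2 ^ d}"
    using determines_strength_bound by blast
  then have fin: "finite ?S"
    using finite_subset by blast
  have "determines_strength 0 k d (Announce 0)"
    by (simp add: determines_strength_def)
  then have ne: "?S \<noteq> {}" by blast
  show ?thesis
    using Max_in[OF fin ne] Max_ge[OF fin] unfolding replacement_height_def by blast
qed

end

theory Submission
  imports Defs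
begin

text \<open>A drop splits the strengths still possible into those below the chosen floor, for which the
  egg breaks, and the rest, for which the supply is restored. So the largest number of strengths
  that \<open>d\<close> drops can tell apart with \<open>e\<close> eggs in hand, \<open>resolvable k e d\<close>, is the sum of the two
  numbers belonging to the two outcomes. A building of height \<open>N\<close> has \<open>N + 1\<close> strengths, hence
  \<open>replacement_height_eq\<close>. The upper bound \<open>card_le_resolvable\<close> is a counting argument over the
  decision tree; the lower bound \<open>resolvable_attained\<close> chooses each floor so that the two outcomes
  split an interval of strengths in exactly the ratio permitted.

  Comparing the recurrence at consecutive numbers of drops makes the two-parameter recursion
  telescope, and leaves for \<open>w d = resolvable k k d\<close> the linear recurrence
  \<open>w (d + 1) = 2 * w d - w (d - k)\<close> (without the last term if \<open>d < k\<close>). By Pascal's rule the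
  alternating sum satisfies the same recurrence, which is checked summand by summand in
  \<open>height_term_rec\<close>.\<close>

section \<open>The number of strengths that can be told apart\<close>

fun resolvable :: "nat \<Rightarrow> nat \<Rightarrow> nat \<Rightarrow> nat" where
  "resolvable k 0 d = 1"
| "resolvable k (Suc e) 0 = 1"
| "resolvable k (Suc e) (Suc d) = resolvable k k d + resolvable k e d"

lemma resolvable_pos: "resolvable k e d \<ge> 1"
  by (induction k e d rule: resolvable.induct) auto

lemma resolvable_zero_drops [simp]: "resolvable k e 0 = 1"
  by (cases e) auto

text \<open>Induction on the tree needs an arbitrary set \<open>S\<close> of strengths, because the root splits it
  into the strengths that break the egg and those that survive, each handled by one subtree.\<close>

lemma card_le_resolvable:
  assumes "finite S"
    and "\<forall>s\<in>S. obeys_replacement N k s e t \<and> drops_used s t \<le> d \<and> announced s t = s"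
  shows "card S \<le> resolvable k e d"
  using assms
proof (induction t arbitrary: S e d)
  case (Announce g)
  then have "S \<subseteq> {g}" by auto
  then have "card S \<le> card {g}" by (intro card_mono) auto
  then show ?case using resolvable_pos[of k e d] by simp
next
  case (Drop x b c)
  show ?case
  proof (cases "S = {}")
    case True
    then show ?thesis by simp
  next
    case False
    then obtain s where s: "s \<in> S" by blast
    then have "e \<ge> 1" "d \<ge> 1" using Drop.prems(2) by fastforce+
    then obtain e' d' where e: "e = Suc e'" and d: "d = Suc d'"
      by (metis Suc_le_D One_nat_def)
    let ?B = "{s \<in> S. s < x}" and ?C = "{s \<in> S. x \<le> s}"
    have below: "obeys_replacement N k s e' b \<and> drops_used s b \<le> d' \<and> announced s b = s"
      if "s \<in> ?B" for s
      using bspec[OF Drop.prems(2), of s] that e d by simp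
    have above: "obeys_replacement N k s k c \<and> drops_used s c \<le> d' \<and> announced s c = s"
      if "s \<in> ?C" for s
      using bspec[OF Drop.prems(2), of s] that e d by simp
    have "card ?B \<le> resolvable k e' d'"
      using Drop.prems(1) below by (intro Drop.IH(1) ballI) simp_all
    moreover have "card ?C \<le> resolvable k k d'"
      using Drop.prems(1) above by (intro Drop.IH(2) ballI) simp_all
    moreover have "S = ?B \<union> ?C" by auto
    then have "card S \<le> card ?B + card ?C" by (metis card_Un_le)
    ultimately show ?thesis using e d by simp
  qed
qed

text \<open>With \<open>e + 1\<close> eggs and \<open>d + 1\<close> drops, the lowest \<open>resolvable k e d\<close> strengths of the interval
  are left to the branch after a break, which fixes the floor to drop from. This floor is positive
  and at most \<open>N\<close> because both branches receive at least one strength.\<close>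

lemma resolvable_attained:
  assumes "a + resolvable k e d \<le> N + 1"
  shows "\<exists>t. \<forall>s\<in>{a..<a + resolvable k e d}.
           obeys_replacement N k s e t \<and> drops_used s t \<le> d \<and> announced s t = s"
  using assms
proof (induction k e d arbitrary: a rule: resolvable.induct)
  case (1 k d)
  show ?case by (rule exI[of _ "Announce a"]) auto
next
  case (2 k e)
  show ?case by (rule exI[of _ "Announce a"]) auto
next
  case (3 k e d)
  let ?x = "a + resolvable k e d"
  obtain b where b: "\<forall>s\<in>{a..<?x}.
      obeys_replacement N k s e b \<and> drops_used s b \<le> d \<and> announced s b = s"
    using 3 by fastforce
  obtain c where c: "\<forall>s\<in>{?x..<?x + resolvable k k d}.
      obeys_replacement N k s k c \<and> drops_used s c \<le> d \<and> announced s c = s"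
    using "3.IH"(1)[of ?x] "3.prems" by auto
  have "?x \<in> {1..N}"
    using "3.prems" resolvable_pos[of k e d] resolvable_pos[of k k d] by auto
  then show ?case
    using b c by (intro exI[of _ "Drop ?x b c"]) auto
qed

lemma replacement_height_eq: "replacement_height k d + 1 = resolvable k k d"
proof (rule antisym)
  obtain t where "determines_strength (replacement_height k d) k d t"
    using replacement_height_greatest by blast
  then have "card {0..replacement_height k d} \<le> resolvable k k d"
    unfolding determines_strength_def by (intro card_le_resolvable) auto
  then show "replacement_height k d + 1 \<le> resolvable k k d" by simp
next
  define N where "N = resolvable k k d - 1"
  have N: "resolvable k k d = N + 1"
    using resolvable_pos[of k k d] by (simp add: N_def)
  then obtain t where "determines_strength N k d t"
    using resolvable_attained[of 0 k k d N]
    by (auto simp: determines_strength_def atLeastLessThanSuc_atLeastAtMost)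
  then have "N \<le> replacement_height k d"
    using replacement_height_greatest by blast
  then show "resolvable k k d \<le> replacement_height k d + 1"
    using N by simp
qed

text \<open>Unfolding the recursion along a run of breaks gives, for \<open>e \<le> d\<close>, the sum of
  \<open>resolvable k k j\<close> over the last \<open>e\<close> values \<open>j < d\<close>, plus \<open>1\<close>. One more drop shifts this window by
  one: it gains \<open>j = d\<close> and loses \<open>j = d - e\<close>. If \<open>d < e\<close>, the eggs cannot run out before the
  drops do, and nothing is lost.\<close>

lemma resolvable_Suc_drops:
  "resolvable k e (Suc d) + (if e \<le> d then resolvable k k (d - e) else 0) =
   resolvable k e d + resolvable k k d"
proof (induction e arbitrary: d)
  case 0
  then show ?case by simp
next
  case (Suc e)
  show ?case
  proof (cases d)
    case 0
    then show ?thesis by simp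
  next
    case (Suc m)
    then show ?thesis using Suc.IH[of m] by (cases "e \<le> m") simp_all
  qed
qed

section \<open>The alternating sum\<close>

definition height_term :: "nat \<Rightarrow> nat \<Rightarrow> nat \<Rightarrow> int" where
  "height_term k d i = (- 1) ^ i * int ((d - i * k) choose i) * 2 ^ (d - i * (k + 1))"

lemma height_term_eq_0:
  assumes "d < i * (k + 1)"
  shows "height_term k d i = 0"
proof -
  have "d - i * k < i" using assms by (cases i) auto
  then show ?thesis by (simp add: height_term_def binomial_eq_0)
qed

text \<open>The recurrence relates sums for different \<open>d\<close>, whose ranges have different lengths; padding
  with zero summands makes the ranges comparable.\<close>

lemma sum_height_term_extend:
  assumes "d div (k + 1) \<le> M"
  shows "(\<Sum>i = 0..d div (k + 1). height_term k d i) = (\<Sum>i\<le>M. height_term k d i)"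
proof (rule sum.mono_neutral_left)
  show "\<forall>i\<in>{..M} - {0..d div (k + 1)}. height_term k d i = 0"
  proof
    fix i assume "i \<in> {..M} - {0..d div (k + 1)}"
    then have "d div (k + 1) < i" by auto
    then have "d < i * (k + 1)" by (subst (asm) div_less_iff_less_mult) auto
    then show "height_term k d i = 0" by (rule height_term_eq_0)
  qed
qed (use assms in auto)

text \<open>Pascal's rule for \<open>(d + 1 - (j + 1) * k) choose (j + 1)\<close>. Truncated subtraction breaks it near
  the end of the range of summation: on the boundary \<open>(j + 1) * (k + 1) = d + 1\<close> the summand for
  \<open>d\<close> vanishes and the other two cancel, and beyond it all three vanish.\<close>

lemma height_term_rec:
  "height_term k (Suc d) (Suc j) =
   2 * height_term k d (Suc j) - (if k \<le> d then height_term k (d - k) j else 0)"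
proof -
  consider "Suc j * (k + 1) \<le> d" | "Suc j * (k + 1) = Suc d" | "Suc j * (k + 1) > Suc d"
    by linarith
  then show ?thesis
  proof cases
    case 1
    then obtain r where d: "d = Suc j * (k + 1) + r" using le_Suc_ex by blast
    have "Suc d - Suc j * k = Suc (Suc j + r)" "d - Suc j * k = Suc j + r"
      "d - k - j * k = Suc j + r" "Suc d - Suc j * (k + 1) = Suc r"
      "d - Suc j * (k + 1) = r" "d - k - j * (k + 1) = Suc r" "k \<le> d"
      using d by (simp_all add: algebra_simps)
    then show ?thesis
      unfolding height_term_def by (simp only: binomial_Suc_Suc) (simp add: algebra_simps)
  next
    case 2
    have "Suc d - Suc j * k = Suc j" "d - k - j * k = j" "Suc d - Suc j * (k + 1) = 0"
      "d - k - j * (k + 1) = 0" "k \<le> d"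
      using 2 by (simp_all add: algebra_simps)
    moreover have "height_term k d (Suc j) = 0" using 2 by (intro height_term_eq_0) simp
    ultimately show ?thesis
      unfolding height_term_def by (simp only: binomial_n_n) simp
  next
    case 3
    have "height_term k (Suc d) (Suc j) = 0"
      using 3 by (rule height_term_eq_0)
    moreover have "height_term k d (Suc j) = 0"
      using 3 by (intro height_term_eq_0) linarith
    moreover have "k \<le> d \<Longrightarrow> height_term k (d - k) j = 0"
      using 3 by (intro height_term_eq_0) simp
    ultimately show ?thesis by simp
  qed
qed

lemma sum_height_term_rec:
  "(\<Sum>i\<le>Suc d. height_term k (Suc d) i) =
   2 * (\<Sum>i\<le>Suc d. height_term k d i) -
   (if k \<le> d then \<Sum>i\<le>d. height_term k (d - k) i else 0)"
proof -
  have "height_term k (Suc d) 0 = 2 * height_term k d 0"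
    by (simp add: height_term_def)
  then show ?thesis
    by (simp add: sum.atMost_Suc_shift height_term_rec sum_subtractf sum_distrib_left
        distrib_left del: sum.atMost_Suc)
qed

lemma resolvable_eq_sum:
  "int (resolvable k k d) = (\<Sum>i = 0..d div (k + 1). height_term k d i)"
proof (induction d rule: less_induct)
  case (less d)
  have IH: "int (resolvable k k m) = (\<Sum>i\<le>M. height_term k m i)" if "m < d" "m \<le> M" for m M
    using less[OF that(1)] sum_height_term_extend[of m k M] that(2)
      div_le_dividend[of m "k + 1"] by linarith
  show ?case
  proof (cases d)
    case 0
    then show ?thesis by (simp add: height_term_def)
  next
    case (Suc m)
    have "int (resolvable k k (Suc m)) = 2 * int (resolvable k k m) -
        (if k \<le> m then int (resolvable k k (m - k)) else 0)"
      using resolvable_Suc_drops[of k k m] by (auto split: if_splits)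
    also have "\<dots> = (\<Sum>i\<le>Suc m. height_term k (Suc m) i)"
      using IH[of m "Suc m"] IH[of "m - k" m] Suc
      by (simp add: sum_height_term_rec del: sum.atMost_Suc)
    also have "\<dots> = (\<Sum>i = 0..Suc m div (k + 1). height_term k (Suc m) i)"
      by (rule sum_height_term_extend[symmetric]) (rule div_le_dividend)
    finally show ?thesis using Suc by simp
  qed
qed

section \<open>The height\<close>

theorem theorem3p4:
  fixes k d :: nat
  assumes "k \<ge> 1"
  shows "int (replacement_height k d) =
    - 1 + (\<Sum>i = 0..d div (k + 1). (- 1) ^ i * int ((d - i * k) choose i) * 2 ^ (d - i * (k + 1)))"
  using replacement_height_eq[of k d] resolvable_eq_sum[of k d]
  unfolding height_term_def by linarith

end
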